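(* Consider a robot with generalized coordinates $q(t)\in\mathbb{R}^N$ and dynamics $M(q)\ddot q + C(q,\dot q)\dot q + g(q) = \tau$, where $\tau\in\mathbb{R}^N$ is the total generalized force. Assume the robot is an Euler-Lagrange system: $M(q)$ is symmetric positive definite and continuously differentiable; $\frac{d}{dt}M(q(t)) - 2C(q(t),\dot q(t))$ is skew-symmetric along trajectories; and $g(q)=\frac{\partial P}{\partial q}(q)$ for a continuously differentiable potential energy $P:\mathbb{R}^N\to\mathbb{R}$ that is bounded below. Let $h_c:\mathbb{R}^N\to\mathbb{R}^n$ be a continuously differentiable operation-space map, and let $z_c=h_c(q)$ and $J_c(q)=\frac{\partial h_c}{\partial q}(q)$, so that $\dot z_c = J_c(q)\dot q$. Let a passive virtual mechanism (as defined in the context), with internal state $x_c$ and internal generalized coordinates $q_c\in\mathbb{R}^{N_c}$ ($N_c\ge 0$), be connected to the robot at the operation-space port $(F_c,\dot z_c)$ by the control law $u = J_c(q)^T F_c$, where $F_c\in\mathbb{R}^n$ is the force the mechanism exerts on the robot. Let $(F_e,\dot z_e)$ be any co-located generalized force / generalized velocity port of the closed loop, that is, $\dot z_e = J_{e,1}\,\dot q + J_{e,2}\,\dot q_c$ for matrices $J_{e,1}=J_{e,1}(q,q_c)$ and $J_{e,2}=J_{e,2}(q,q_c)$ depending continuously on $(q,q_c)$, with the external force $F_e$ acting through the transposes of the same matrices. The closed loop is thus the robot with $\tau = u + J_{e,1}^T F_e$ and $u = J_c(q)^T F_c$, together with the virtual mechanism driven by the velocity $\dot z_c = J_c(q)\dot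 q$ and the internal generalized force $\tau_c = J_{e,2}^T F_e$. Then the closed-loop system is passive at the port $(F_e,\dot z_e)$: there exists a function $S$ of the closed-loop state $(q,\dot q,x_c)$, bounded below, such that along every closed-loop trajectory and for all $t_0\le t_1$ in its interval of existence, $$S(t_1)-S(t_0)\le \int_{t_0}^{t_1} F_e(t)^T\dot z_e(t)\,dt .$$
   Context: Passivity: a system with state $x$ is passive at a port consisting of an effort (force) $F$ and a flow (velocity) $\dot z$ of equal dimension, where $F^T\dot z$ is the power flowing into the system, if there is a storage function $S(x)$, bounded below, such that $S(x(t_1))-S(x(t_0))\le\int_{t_0}^{t_1}F^T\dot z\,dt$ along every trajectory and for all $t_0\le t_1$ in its interval of existence. Trajectories: $q$ is taken twice continuously differentiable in time and all port signals continuous in time. Virtual mechanism controller: a controller that acts on the generalized force $u$ of the robot by feedback from $q,\dot q$, emulating a virtual mechanism (an interconnection of ideal springs, dampers, inerters, masses, joints and similar elements) attached to the robot at the operation-space port. The operation-space Jacobian $J_c(q)$ relates the control port $(u,\dot q)$ to the operation-space port through $\dot z_c=J_c(q)\dot q$ and $u=J_c(q)^TF_c$. Passive virtual mechanism: a system with state $x_c$, which may contain internal generalized coordinates $q_c\in\mathbb{R}^{N_c}$ (the coordinates of virtual joints and links; $N_c=0$ is allowed), specified by a set of admissible trajectories $(x_c,\dot z_c,F_c,\tau_c,\dot q_c)$. Here $F_c$ is the force exerted by the mechanism on the robot at the operation-space port, and $\tau_c\in\mathbb{R}^{N_c}$ is the generalized force applied externally to the internal coordinates $q_c$. The mechanism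 is passive at its ports: there is a function $S_c(x_c)$, bounded below, such that along all its trajectories and for all $t_0\le t_1$, $$S_c(x_c(t_1))-S_c(x_c(t_0))\le\int_{t_0}^{t_1}\left(-F_c^T\dot z_c+\tau_c^T\dot q_c\right)dt .$$ The minus sign reflects that $F_c$ acts on the robot, so that the power flowing into the mechanism at the operation-space port is $-F_c^T\dot z_c$. *)

theory Defs
  imports "HOL-Analysis.Analysis"
begin

definition cont_differentiable :: "('a::euclidean_space \<Rightarrow> 'b::real_normed_vector) \<Rightarrow> bool" where
  "cont_differentiable f \<longleftrightarrow>
     (\<exists>f' :: 'a \<Rightarrow> 'a \<Rightarrow>\<^sub>L 'b.
        (\<forall>x. (f has_derivative blinfun_apply (f' x)) (at x)) \<and> continuous_on UNIV f')"

(* Degenerate intervals are excluded so that derivatives within T are unique. *)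
definition time_interval :: "real set \<Rightarrow> bool" where
  "time_interval T \<longleftrightarrow> is_interval T \<and> interior T \<noteq> {}"


(* R^{N_c} has to include N_c = 0, which no type real^'k provides.  It is represented by the
   functions nat => real that vanish from index N_c on; on this set the product topology
   of the function type is the Euclidean topology.  An (m x N_c)-matrix is given by its columns
   A 0, ..., A (N_c - 1), each in real^'m. *)

definition coord_space :: "nat \<Rightarrow> (nat \<Rightarrow> real) set" where
  "coord_space Nc = {v. \<forall>j\<ge>Nc. v j = 0}"

definition cols_mult :: "nat \<Rightarrow> (nat \<Rightarrow> real^'m) \<Rightarrow> (nat \<Rightarrow> real) \<Rightarrow> real^'m" where
  "cols_mult Nc A v = (\<Sum>j<Nc. v j *\<^sub>R A j)"

definition cols_transpose_mult :: "nat \<Rightarrow> (nat \<Rightarrow> real^'m) \<Rightarrow> real^'m \<Rightarrow> (nat \<Rightarrow> real)" where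
  "cols_transpose_mult Nc A F = (\<lambda>j. if j < Nc then A j \<bullet> F else 0)"


(* A system is represented by its set of trajectories.  Every trajectory comes with its interval
   of existence T as first component; its signals are only relevant on T. *)

definition storage_inequality ::
    "('s \<Rightarrow> real) \<Rightarrow> real set \<Rightarrow> (real \<Rightarrow> 's) \<Rightarrow> (real \<Rightarrow> real) \<Rightarrow> bool" where
  "storage_inequality S T x w \<longleftrightarrow>
     (\<forall>t0\<in>T. \<forall>t1\<in>T. t0 \<le> t1 \<longrightarrow> S (x t1) - S (x t0) \<le> integral {t0..t1} w)"

(* Trajectories are tuples (T, x, F, dz) with state x, effort F and flow dz. *)
definition passive_at_port ::
    "(real set \<times> (real \<Rightarrow> 's) \<times> (real \<Rightarrow> real^'m) \<times> (real \<Rightarrow> real^'m)) set \<Rightarrow> bool" where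
  "passive_at_port B \<longleftrightarrow>
     (\<exists>S. bdd_below (range S) \<and>
        (\<forall>(T, x, F, dz)\<in>B. storage_inequality S T x (\<lambda>t. F t \<bullet> dz t)))"


(* Trajectories (T, xc, dzc, Fc, tauc, dqc) of a virtual mechanism. *)
type_synonym ('x, 'n) mech_trajectory =
  "real set \<times> (real \<Rightarrow> 'x) \<times> (real \<Rightarrow> real^'n) \<times> (real \<Rightarrow> real^'n) \<times>
   (real \<Rightarrow> nat \<Rightarrow> real) \<times> (real \<Rightarrow> nat \<Rightarrow> real)"

(* qc reads the internal coordinates off the mechanism state. *)
definition virtual_mechanism ::
    "nat \<Rightarrow> ('x \<Rightarrow> nat \<Rightarrow> real) \<Rightarrow> ('x, 'n::finite) mech_trajectory set \<Rightarrow> bool" where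
  "virtual_mechanism Nc qc B \<longleftrightarrow>
     range qc \<subseteq> coord_space Nc \<and>
     (\<forall>(T, xc, dzc, Fc, tauc, dqc)\<in>B.
        time_interval T \<and>
        continuous_on T dzc \<and> continuous_on T Fc \<and>
        continuous_on T tauc \<and> tauc ` T \<subseteq> coord_space Nc \<and>
        continuous_on T dqc \<and> dqc ` T \<subseteq> coord_space Nc \<and>
        (\<forall>t\<in>T. \<forall>j<Nc. ((\<lambda>s. qc (xc s) j) has_real_derivative dqc t j) (at t within T)))"

(* Fc acts on the robot, whence the sign of the power at the operation-space port. *)
definition passive_mechanism ::
    "nat \<Rightarrow> ('x, 'n::finite) mech_trajectory set \<Rightarrow> bool" where
  "passive_mechanism Nc B \<longleftrightarrow>
     (\<exists>Sc. bdd_below (range Sc) \<and>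
        (\<forall>(T, xc, dzc, Fc, tauc, dqc)\<in>B.
           storage_inequality Sc T xc
             (\<lambda>t. - (Fc t \<bullet> dzc t) + (\<Sum>j<Nc. tauc t j * dqc t j))))"


definition robot_trajectory ::
    "(real^'N \<Rightarrow> real^'N^'N) \<Rightarrow> (real^'N \<Rightarrow> real^'N \<Rightarrow> real^'N^'N) \<Rightarrow> (real^'N \<Rightarrow> real^'N) \<Rightarrow>
     real set \<Rightarrow> (real \<Rightarrow> real^'N) \<Rightarrow> (real \<Rightarrow> real^'N) \<Rightarrow> (real \<Rightarrow> real^'N) \<Rightarrow> bool" where
  "robot_trajectory M C g T q dq tau \<longleftrightarrow>
     time_interval T \<and> continuous_on T tau \<and>
     (\<exists>ddq. continuous_on T ddq \<and>
        (\<forall>t\<in>T. (q has_vector_derivative dq t) (at t within T) \<and>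
               (dq has_vector_derivative ddq t) (at t within T) \<and>
               M (q t) *v ddq t + C (q t) (dq t) *v dq t + g (q t) = tau t))"

definition euler_lagrange ::
    "(real^'N \<Rightarrow> real^'N^'N) \<Rightarrow> (real^'N \<Rightarrow> real^'N \<Rightarrow> real^'N^'N) \<Rightarrow> (real^'N \<Rightarrow> real^'N) \<Rightarrow>
     (real^'N \<Rightarrow> real) \<Rightarrow> bool" where
  "euler_lagrange M C g P \<longleftrightarrow>
     (\<forall>q. transpose (M q) = M q \<and> (\<forall>v. v \<noteq> 0 \<longrightarrow> 0 < v \<bullet> (M q *v v))) \<and>
     cont_differentiable M \<and>
     (\<forall>T q dq tau. robot_trajectory M C g T q dq tau \<longrightarrow>
        (\<forall>t\<in>T. let A = vector_derivative (\<lambda>s. M (q s)) (at t within T) - 2 *\<^sub>R C (q t) (dq t)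
                in transpose A = - A)) \<and>
     cont_differentiable P \<and> bdd_below (range P) \<and> (\<forall>q. GDERIV P q :> g q)"


(* The flow is dze = Je1 dq + Je2 dqc, and the external force Fe acts through the transposes. *)
definition closed_loop ::
    "(real^'N \<Rightarrow> real^'N^'N) \<Rightarrow> (real^'N \<Rightarrow> real^'N \<Rightarrow> real^'N^'N) \<Rightarrow> (real^'N \<Rightarrow> real^'N) \<Rightarrow>
     (real^'N \<Rightarrow> real^'n) \<Rightarrow>
     nat \<Rightarrow> ('x \<Rightarrow> nat \<Rightarrow> real) \<Rightarrow> ('x, 'n) mech_trajectory set \<Rightarrow>
     (real^'N \<Rightarrow> (nat \<Rightarrow> real) \<Rightarrow> real^'N^'e) \<Rightarrow> (real^'N \<Rightarrow> (nat \<Rightarrow> real) \<Rightarrow> nat \<Rightarrow> real^'e) \<Rightarrow>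
     (real set \<times> (real \<Rightarrow> (real^'N) \<times> (real^'N) \<times> 'x) \<times> (real \<Rightarrow> real^'e) \<times> (real \<Rightarrow> real^'e)) set"
  where
  "closed_loop M C g hc Nc qc B Je1 Je2 =
     {(T, (\<lambda>t. (q t, dq t, xc t)), Fe, dze) | T q dq xc Fe dze.
        \<exists>tau u dzc Fc tauc dqc.
          robot_trajectory M C g T q dq tau \<and>
          (T, xc, dzc, Fc, tauc, dqc) \<in> B \<and>
          continuous_on T Fe \<and>
          (\<forall>t\<in>T.
             dzc t = jacobian hc (at (q t)) *v dq t \<and>
             u t = transpose (jacobian hc (at (q t))) *v Fc t \<and>
             tau t = u t + transpose (Je1 (q t) (qc (xc t))) *v Fe t \<and>
             tauc t = cols_transpose_mult Nc (Je2 (q t) (qc (xc t))) (Fe t) \<and>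
             dze t = Je1 (q t) (qc (xc t)) *v dq t
                     + cols_mult Nc (Je2 (q t) (qc (xc t))) (dqc t))}"

end

(* The storage function is the total energy of the robot plus that of the mechanism.  Since
   dM/dt - 2C is skew, the robot's energy changes exactly at the rate dq . tau; the power
   dq . J_c^T F_c = F_c . dz_c exchanged at the operation-space port cancels against the
   mechanism's supply, and the transposed Jacobians turn the rest into F_e . dz_e. *)
theory Submission
  imports Defs
begin

text \<open>Provides the product rule for \<open>M (q s) *v dq s\<close>, where matrix and vector
  both vary with time.\<close>

lemma bounded_bilinear_matrix_vector_mult:
  "bounded_bilinear ((*v) :: real^'n^'m \<Rightarrow> real^'n \<Rightarrow> real^'m)"
proof -
  have "bilinear ((*v) :: real^'n^'m \<Rightarrow> real^'n \<Rightarrow> real^'m)"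
    unfolding bilinear_def
    by (intro conjI allI matrix_vector_mul_linear)
      (auto intro: linearI simp: matrix_vector_mult_add_rdistrib scaleR_matrix_vector_assoc)
  then show ?thesis
    by (simp add: bilinear_conv_bounded_bilinear)
qed

text \<open>Moving \<open>A\<close> to the other argument transposes it, so the quadratic form
  equals its own negative.\<close>

lemma skew_quadratic_form_zero:
  fixes A :: "real^'n^'n"
  assumes "transpose A = - A"
  shows "v \<bullet> (A *v v) = 0"
proof -
  have "v \<bullet> (A *v v) = (transpose A *v v) \<bullet> v"
    by (simp add: dot_lmul_matrix)
  also have "\<dots> = - (v \<bullet> (A *v v))"
    unfolding assms
    by (simp add: bounded_bilinear.minus_left[OF bounded_bilinear_matrix_vector_mult] inner_commute)
  finally show ?thesis by simp
qed

text \<open>A connected set with more than one point has no isolated points. This makes derivatives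
  within \<open>T\<close> unique, endpoints included, so that \<open>vector_derivative\<close> in
  \<open>euler_lagrange\<close> can be computed by the chain rule.\<close>

lemma within_time_interval_nontrivial:
  assumes "time_interval T" "t \<in> T"
  shows "at t within T \<noteq> bot"
proof -
  have "connected T" "interior T \<noteq> {}"
    using assms by (auto simp: time_interval_def is_interval_connected)
  then have "\<nexists>a. T = {a}" by auto
  then show ?thesis
    using \<open>connected T\<close> assms(2) connected_imp_perfect trivial_limit_within by blast
qed

lemma time_interval_Icc_subset:
  assumes "time_interval T" "t0 \<in> T" "t1 \<in> T"
  shows "{t0..t1} \<subseteq> T"
  using assms interval_subset_is_interval[of T t0 t1] by (auto simp: time_interval_def cbox_interval)

definition energy :: "(real^'N \<Rightarrow> real^'N^'N) \<Rightarrow> (real^'N \<Rightarrow> real) \<Rightarrow> real^'N \<Rightarrow> real^'N \<Rightarrow> real" where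
  "energy M P q v = v \<bullet> (M q *v v) / 2 + P q"

text \<open>Positive definiteness makes the kinetic term nonnegative, so any lower bound of
  \<open>P\<close> will do.\<close>

lemma energy_bounded_below:
  assumes "euler_lagrange M C g P"
  obtains b where "\<And>q v. b \<le> energy M P q v"
proof -
  obtain b where b: "\<And>q. b \<le> P q"
    using assms unfolding euler_lagrange_def bdd_below_def by auto
  have "0 \<le> v \<bullet> (M q *v v)" for q v
    using assms unfolding euler_lagrange_def by (cases "v = 0") (auto intro: less_imp_le)
  then have "b \<le> energy M P q v" for q v
    using b[of q] unfolding energy_def by (smt (verit) divide_nonneg_pos)
  then show thesis by (rule that)
qed

text \<open>Differentiating the kinetic energy gives two acceleration terms, which symmetry of
  \<open>M\<close> merges into one, and half of the quadratic form of dM/dt, which skewness turns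
  into the Coriolis power. With the gradient term from \<open>P\<close>, this is \<open>dq t\<close>
  paired with the left side of the equation of motion.\<close>

lemma energy_derivative:
  assumes EL: "euler_lagrange M C g P"
    and traj: "robot_trajectory M C g T q dq tau"
    and t: "t \<in> T"
  shows "((\<lambda>s. energy M P (q s) (dq s)) has_vector_derivative dq t \<bullet> tau t) (at t within T)"
proof -
  obtain ddq where dq: "(q has_vector_derivative dq t) (at t within T)"
    and ddq: "(dq has_vector_derivative ddq t) (at t within T)"
    and dyn: "M (q t) *v ddq t + C (q t) (dq t) *v dq t + g (q t) = tau t"
    and T: "time_interval T"
    using traj t unfolding robot_trajectory_def by blast
  obtain M' where "(M has_derivative M') (at (q t))"
    using EL unfolding euler_lagrange_def cont_differentiable_def by blast
  then have dM: "((\<lambda>s. M (q s)) has_vector_derivative M' (dq t)) (at t within T)"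
    using vector_derivative_diff_chain_within[OF dq has_derivative_at_withinI] by (simp add: o_def)
  let ?D = "M' (dq t)" and ?C = "C (q t) (dq t)" and ?v = "dq t"
  \<comment> \<open>Uniqueness of the derivative identifies the \<open>vector_derivative\<close> of
    the skewness hypothesis with \<open>?D\<close>.\<close>
  have "transpose (?D - 2 *\<^sub>R ?C) = - (?D - 2 *\<^sub>R ?C)"
    using EL traj t vector_derivative_within[OF within_time_interval_nontrivial[OF T t] dM]
    unfolding euler_lagrange_def Let_def by metis
  from skew_quadratic_form_zero[OF this, of ?v]
  have skew: "?v \<bullet> (?D *v ?v) = 2 * (?v \<bullet> (?C *v ?v))"
    by (simp add: matrix_vector_mult_diff_rdistrib inner_diff_right scaleR_matrix_vector_assoc[symmetric])
  have sym: "ddq t \<bullet> (M (q t) *v ?v) = ?v \<bullet> (M (q t) *v ddq t)"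
    using EL dot_lmul_matrix[of "ddq t" "M (q t)" ?v] transpose_matrix_vector[of "M (q t)" "ddq t"]
    unfolding euler_lagrange_def by (simp add: inner_commute)
  have "GDERIV P (q t) :> g (q t)"
    using EL unfolding euler_lagrange_def by blast
  then have dP: "((\<lambda>s. P (q s)) has_vector_derivative ?v \<bullet> g (q t)) (at t within T)"
    using vector_derivative_diff_chain_within[OF dq has_derivative_at_withinI]
    by (simp add: o_def gderiv_def)
  have dMv: "((\<lambda>s. M (q s) *v dq s) has_vector_derivative M (q t) *v ddq t + ?D *v ?v) (at t within T)"
    using bounded_bilinear.has_vector_derivative[OF bounded_bilinear_matrix_vector_mult dM ddq] .
  have "((\<lambda>s. dq s \<bullet> (M (q s) *v dq s)) has_vector_derivative
      ?v \<bullet> (M (q t) *v ddq t + ?D *v ?v) + ddq t \<bullet> (M (q t) *v ?v)) (at t within T)"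
    using bounded_bilinear.has_vector_derivative[OF bounded_bilinear_inner ddq dMv] .
  from has_vector_derivative_add[OF has_vector_derivative_divide[OF this, of 2] dP]
  show ?thesis
    unfolding energy_def dyn[symmetric]
    by (simp add: inner_add_right skew sym add_divide_distrib)
qed

text \<open>The fundamental theorem of calculus; the form with \<open>has_integral\<close> also
  records that the power is integrable.\<close>

lemma energy_balance:
  assumes "euler_lagrange M C g P"
    and "robot_trajectory M C g T q dq tau"
    and "t0 \<in> T" "t1 \<in> T" "t0 \<le> t1"
  shows "((\<lambda>t. dq t \<bullet> tau t) has_integral
      energy M P (q t1) (dq t1) - energy M P (q t0) (dq t0)) {t0..t1}"
proof -
  have "{t0..t1} \<subseteq> T"
    using assms(2-4) time_interval_Icc_subset unfolding robot_trajectory_def by blast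
  then show ?thesis
    using energy_derivative[OF assms(1,2)]
    by (intro fundamental_theorem_of_calculus assms)
      (blast intro: has_vector_derivative_within_subset)
qed

text \<open>\<open>integral\<close> is 0 by default for a function that is not integrable.
  Continuity of the port signals excludes this case, so the mechanism's supply can be added to the
  robot's energy balance.\<close>

lemma mechanism_power_integrable:
  assumes "virtual_mechanism Nc qc B" "(T, xc, dzc, Fc, tauc, dqc) \<in> B"
    and "t0 \<in> T" "t1 \<in> T"
  shows "(\<lambda>t. - (Fc t \<bullet> dzc t) + (\<Sum>j<Nc. tauc t j * dqc t j)) integrable_on {t0..t1}"
proof -
  have *: "time_interval T" "continuous_on T dzc" "continuous_on T Fc"
    "continuous_on T tauc" "continuous_on T dqc"
    using bspec[OF conjunct2[OF assms(1)[unfolded virtual_mechanism_def]] assms(2)] by auto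
  have "{t0..t1} \<subseteq> T"
    using *(1) assms(3,4) by (rule time_interval_Icc_subset)
  moreover have "continuous_on T (\<lambda>t. - (Fc t \<bullet> dzc t) + (\<Sum>j<Nc. tauc t j * dqc t j))"
    \<comment> \<open>Continuity in the product topology yields continuity of each coordinate of
      \<open>tauc\<close> and \<open>dqc\<close>.\<close>
    using continuous_on_product_then_coordinatewise[OF *(4)]
      continuous_on_product_then_coordinatewise[OF *(5)]
    by (intro continuous_on_add continuous_on_minus continuous_on_inner continuous_on_sum
        continuous_on_mult *)
  ultimately show ?thesis
    by (intro integrable_continuous_real) (rule continuous_on_subset)
qed

text \<open>The two column operations are adjoint: the external force does the same work on the flow
  \<open>cols_mult Nc A v\<close> as its pullback does on the internal velocities.\<close>

lemma inner_cols_mult: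
  "F \<bullet> cols_mult Nc A v = (\<Sum>j<Nc. cols_transpose_mult Nc A F j * v j)"
  by (simp add: cols_mult_def cols_transpose_mult_def inner_sum_right inner_commute[of F] mult.commute)

theorem theorem1:
  fixes M :: "real^'N \<Rightarrow> real^'N^'N"
    and C :: "real^'N \<Rightarrow> real^'N \<Rightarrow> real^'N^'N"
    and g :: "real^'N \<Rightarrow> real^'N"
    and P :: "real^'N \<Rightarrow> real"
    and hc :: "real^'N \<Rightarrow> real^'n"
    and Nc :: nat
    and qc :: "'x \<Rightarrow> nat \<Rightarrow> real"
    and B :: "('x, 'n) mech_trajectory set"
    and Je1 :: "real^'N \<Rightarrow> (nat \<Rightarrow> real) \<Rightarrow> real^'N^'e"
    and Je2 :: "real^'N \<Rightarrow> (nat \<Rightarrow> real) \<Rightarrow> nat \<Rightarrow> real^'e"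
  assumes "euler_lagrange M C g P"
    and "cont_differentiable hc"
    and "virtual_mechanism Nc qc B"
    and "passive_mechanism Nc B"
    and "continuous_on (UNIV \<times> coord_space Nc) (\<lambda>(q, p). Je1 q p)"
    and "\<And>j. j < Nc \<Longrightarrow> continuous_on (UNIV \<times> coord_space Nc) (\<lambda>(q, p). Je2 q p j)"
  shows "passive_at_port (closed_loop M C g hc Nc qc B Je1 Je2)"
proof -
  obtain Sc where Sc_bdd: "bdd_below (range Sc)"
    and Sc: "\<And>T xc dzc Fc tauc dqc. (T, xc, dzc, Fc, tauc, dqc) \<in> B \<Longrightarrow>
      storage_inequality Sc T xc (\<lambda>t. - (Fc t \<bullet> dzc t) + (\<Sum>j<Nc. tauc t j * dqc t j))"
    using assms(4) unfolding passive_mechanism_def by fastforce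
  obtain b where b: "\<And>q v. b \<le> energy M P q v"
    using energy_bounded_below[OF assms(1)] by blast
  obtain c where c: "\<And>x. c \<le> Sc x"
    using Sc_bdd unfolding bdd_below_def by auto
  define S where "S = (\<lambda>(q, v, x). energy M P q v + Sc x)"
  have "b + c \<le> S s" for s
    unfolding S_def by (auto simp: case_prod_beta intro: add_mono b c)
  then have "bdd_below (range S)"
    by (auto intro!: bdd_belowI2)
  moreover have "storage_inequality S T x (\<lambda>t. Fe t \<bullet> dze t)"
    if loop: "(T, x, Fe, dze) \<in> closed_loop M C g hc Nc qc B Je1 Je2" for T x Fe dze
    unfolding storage_inequality_def
  proof (intro ballI impI)
    fix t0 t1 assume t: "t0 \<in> T" "t1 \<in> T" "t0 \<le> t1"
    obtain q dq xc tau u dzc Fc tauc dqc where x: "x = (\<lambda>t. (q t, dq t, xc t))"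
      and traj: "robot_trajectory M C g T q dq tau"
      and mech: "(T, xc, dzc, Fc, tauc, dqc) \<in> B"
      and eqs: "\<And>t. t \<in> T \<Longrightarrow>
             dzc t = jacobian hc (at (q t)) *v dq t \<and>
             u t = transpose (jacobian hc (at (q t))) *v Fc t \<and>
             tau t = u t + transpose (Je1 (q t) (qc (xc t))) *v Fe t \<and>
             tauc t = cols_transpose_mult Nc (Je2 (q t) (qc (xc t))) (Fe t) \<and>
             dze t = Je1 (q t) (qc (xc t)) *v dq t
                     + cols_mult Nc (Je2 (q t) (qc (xc t))) (dqc t)"
      using loop unfolding closed_loop_def by auto
    let ?w = "\<lambda>t. - (Fc t \<bullet> dzc t) + (\<Sum>j<Nc. tauc t j * dqc t j)"
    have power: "dq t \<bullet> tau t + ?w t = Fe t \<bullet> dze t" if "t \<in> T" for t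
      using eqs[OF that]
      by (simp add: inner_add_right inner_cols_mult dot_lmul_matrix inner_commute[of "dq t"])
    have "{t0..t1} \<subseteq> T"
      using traj t(1,2) time_interval_Icc_subset unfolding robot_trajectory_def by blast
    have "((\<lambda>t. dq t \<bullet> tau t + ?w t) has_integral
        energy M P (q t1) (dq t1) - energy M P (q t0) (dq t0) + integral {t0..t1} ?w) {t0..t1}"
      by (intro has_integral_add energy_balance[OF assms(1) traj t] integrable_integral
          mechanism_power_integrable[OF assms(3) mech t(1,2)])
    \<comment> \<open>The identity \<open>power\<close> holds on \<open>T\<close> only, which
      suffices on \<open>{t0..t1}\<close>. Integrability of the supplied power is inherited from the
      two summands, so the integral in the goal is not a default value.\<close>
    then have "((\<lambda>t. Fe t \<bullet> dze t) has_integral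
        energy M P (q t1) (dq t1) - energy M P (q t0) (dq t0) + integral {t0..t1} ?w) {t0..t1}"
      by (rule has_integral_eq[rotated]) (use power \<open>{t0..t1} \<subseteq> T\<close> in blast)
    moreover have "Sc (xc t1) - Sc (xc t0) \<le> integral {t0..t1} ?w"
      using Sc[OF mech] t unfolding storage_inequality_def by blast
    ultimately show "S (x t1) - S (x t0) \<le> integral {t0..t1} (\<lambda>t. Fe t \<bullet> dze t)"
      by (simp add: integral_unique S_def x)
  qed
  ultimately show ?thesis
    unfolding passive_at_port_def by (intro exI[of _ S] conjI ballI) auto
qed

end
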